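(* We have $$\sum_{k=0}^\infty \frac{\binom{2k}{k} \left( (20k^2+44k+25)(H_{2k}-H_k) -2\,\frac{120k^3+388k^2+434k+167}{(2k+1)(2k+3)} \right)}{(2k+1)^4 (2k+3)^4 (-16)^k} = \frac{1}{16}\pi^2 \ln 2 - \frac{3}{4} - \frac{7\,\zeta(3)}{8}.$$
   Context: For $n\in\{0,1,2,\ldots\}$, $H_n=\sum_{0<j\le n}\frac1j$ denotes the usual harmonic number (so $H_0=0$). $\zeta$ is the Riemann zeta function and $\ln$ is the natural logarithm. *)

theory Defs
  imports "HOL-Analysis.Analysis"
begin

text \<open>
  The Riemann zeta function on the real half-line \<open>s > 1\<close>, where it is given by its
  Dirichlet series (shifted so that the sum starts at index 0).  For \<open>s \<le> 1\<close> the series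
  diverges and the value is meaningless; no analytic continuation is intended.
\<close>

definition riemann_zeta :: "real \<Rightarrow> real" where
  "riemann_zeta s = (\<Sum>n. 1 / real (Suc n) powr s)"

end

theory Submission
  imports Defs "HOL-Real_Asymp.Real_Asymp"
begin

text \<open>
  The series is evaluated by differentiating a Wilf-Zeilberger pair with respect to a parameter. For
  real \<open>x > 0\<close> and natural \<open>m\<close> put
  \<open>K(m, x) = \<Gamma>(x)\<^sup>2 \<Gamma>(m + 1) / \<Gamma>(m + 2 x)\<close>, \<open>F(m, x) = K(m, x) / (m + x)\<^sup>2\<close> and
  \<open>G(m, x) = K(m, x) / (2 x (m + 2 x))\<close>. Then
  \<open>- F(m, x + 1) - F(m + 1, x) = G(m + 1, x) - G(m, x)\<close>,
  and summation over all \<open>m\<close> and over all integer shifts of \<open>x\<close> gives the acceleration formula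
  \<open>\<Sum>\<^sub>m F(m, x) = \<Sum>\<^sub>j (-1)\<^sup>j (F + G)(0, x + j)\<close>. At \<open>x = 1\<close> this is Apery's alternating series for
  \<open>\<zeta>(3)\<close>.

  The relation holds identically in \<open>x\<close>, so its \<open>x\<close>-derivative is again such a relation. At
  \<open>x = 1/2\<close> the Gamma quotients on the right become \<open>binomial(2 j, j) / (-16)\<^sup>j\<close> and the digamma values become
  harmonic numbers. The differentiated values are written down explicitly below as \<open>wz_F\<close> and \<open>wz_G\<close>, and
  \<open>wz_relation\<close> is checked from the recurrences of binomial coefficients and harmonic numbers, so that
  neither Gamma functions nor termwise differentiation enter. Letting a rectangle of this relation
  grow (\<open>wz_edge_sums\<close>) yields, with \<open>b = m + 1/2\<close>,
  \<open>5 \<Sum>\<^sub>k binomial(2 k, k) / (-16)\<^sup>k ((H\<^sub>2\<^sub>k - H\<^sub>k) / (2 k + 1)\<^sup>2 - 2 / (2 k + 1)\<^sup>3) = - \<Sum>\<^sub>m (H\<^sub>m / b\<^sup>2 + 1 / b\<^sup>3)\<close>.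

  The right-hand side is \<open>\<pi>\<^sup>2 ln 2 - 14 \<zeta>(3)\<close>: here \<open>\<Sum> 1 / b\<^sup>3 = 7 \<zeta>(3)\<close>, and
  \<open>\<Sum> (H\<^sub>m / b\<^sup>2 - 1 / b\<^sup>3) = - \<pi>\<^sup>2 ln 2\<close> is the limit of the finite identity \<open>reflection_identity\<close>.

  The summand of the theorem is half the derivative in \<open>k\<close> of
  \<open>binomial(2 k, k) (20 k\<^sup>2 + 44 k + 25) / ((2 k + 1)\<^sup>4 (2 k + 3)\<^sup>4)\<close>, with the factor \<open>(-16)\<^sup>-\<^sup>k\<close>
  kept constant. Undifferentiated, it is \<open>5 binomial(2 k, k) / (16 (2 k + 1)\<^sup>2 (-16)\<^sup>k)\<close> plus a difference
  of consecutive hypergeometric terms. This equation survives differentiation, since keeping the power of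
  16 constant changes the derivative only by a multiple of the equation itself (\<open>summand_eq\<close>). So the
  theorem's sum is \<open>(\<pi>\<^sup>2 ln 2 - 14 \<zeta>(3)) / 16\<close> plus a boundary term at \<open>k = 0\<close>, which equals
  \<open>- 3 / 4\<close>.
\<close>

section \<open>Harmonic numbers and sums over half-integers\<close>

abbreviation plus_half :: "nat \<Rightarrow> real" where "plus_half j \<equiv> real j + 1 / 2"

lemma sum_inverse_Suc: "(\<Sum>m<N. 1 / (real m + 1)) = harm N"
  by (simp add: harm_altdef inverse_eq_divide add.commute)

lemma sum_inverse_reversed: "(\<Sum>m<N. 1 / (real N - real m)) = harm N"
proof -
  have "harm N = (\<Sum>m<N. 1 / (real (N - Suc m) + 1))"
    unfolding sum_inverse_Suc [symmetric] by (rule sum.nat_diff_reindex [symmetric])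
  also have "\<dots> = (\<Sum>m<N. 1 / (real N - real m))"
    by (rule sum.cong) (auto simp: of_nat_diff)
  finally show ?thesis ..
qed

lemma sum_inverse_plus_half: "(\<Sum>i<N. 1 / plus_half i) = 2 * harm (2 * N) - harm N"
proof (induction N)
  case (Suc N)
  have "1 / plus_half N = 2 * (1 / (real (2 * N) + 1) + 1 / (real (2 * N) + 2)) - 1 / (real N + 1)"
    by (simp add: divide_simps) (simp add: algebra_simps)
  with Suc show ?case by (simp add: harm_Suc inverse_eq_divide algebra_simps)
qed (simp add: harm_expand)

lemma harm_le_self: "harm n \<le> real n"
proof (induction n)
  case (Suc n)
  have "inverse (real (Suc n)) \<le> 1" by (simp add: inverse_eq_divide)
  with Suc show ?case by (simp add: harm_Suc)
qed (simp add: harm_expand)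

lemma harm_diff_le:
  assumes "m < N"
  shows "harm N - harm (N - 1 - m) \<le> real (m + 1) / (real N - real m)"
proof -
  have *: "harm (k + Suc m) - harm k \<le> real (Suc m) / (real k + 1)" for k
  proof (induction m)
    case (Suc m)
    have "1 / (real k + real m + 2) \<le> 1 / (real k + 1)"
      by (intro divide_left_mono) auto
    with Suc show ?case
      by (simp add: harm_Suc inverse_eq_divide add_divide_distrib algebra_simps)
  qed (simp add: harm_Suc inverse_eq_divide add.commute)
  from *[of "N - 1 - m"] assms show ?thesis
    by (simp add: of_nat_diff)
qed

lemma harm_double_diff_tendsto: "(\<lambda>N. harm (2 * N) - harm N :: real) \<longlonglongrightarrow> ln 2"
proof -
  let ?e = "\<lambda>n. harm n - ln (real n)"
  have "(\<lambda>N. ?e (2 * N) - ?e N + ln 2) \<longlonglongrightarrow> euler_mascheroni - euler_mascheroni + ln 2"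
    by (intro tendsto_intros euler_mascheroni_LIMSEQ filterlim_compose[OF euler_mascheroni_LIMSEQ]
          filterlim_subseq) (auto simp: strict_mono_def)
  moreover have "\<forall>\<^sub>F N in sequentially. ?e (2 * N) - ?e N + ln 2 = harm (2 * N) - harm N"
    using eventually_gt_at_top[of 0] by eventually_elim (simp add: ln_mult)
  ultimately show ?thesis using tendsto_cong by fastforce
qed

lemma harm_over_n_tendsto_0: "(\<lambda>n. harm n / real n) \<longlonglongrightarrow> 0"
proof -
  have "(\<lambda>n. (harm n - ln (real n)) * (1 / real n) + ln (real n) / real n)
      \<longlonglongrightarrow> euler_mascheroni * 0 + 0"
    by (intro tendsto_add tendsto_mult euler_mascheroni_LIMSEQ) real_asymp+
  thus ?thesis by (simp add: diff_divide_distrib)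
qed

text \<open>
  This removes the even-numbered reciprocals from a zeta series written from index \<open>0\<close>: there the odd
  indices carry the even integers, and \<open>c\<close> is \<open>1 / 4\<close> for squares and \<open>1 / 8\<close> for cubes.
\<close>
lemma sums_even_indices:
  fixes f :: "nat \<Rightarrow> real"
  assumes f: "f sums s" and odd: "\<And>n. f (2 * n + 1) = c * f n"
  shows "(\<lambda>n. f (2 * n)) sums ((1 - c) * s)"
proof -
  have "(\<lambda>N. (\<Sum>n<2 * N. f n) - c * (\<Sum>n<N. f n)) \<longlonglongrightarrow> s - c * s"
    using f LIMSEQ_subseq_LIMSEQ[of "\<lambda>N. \<Sum>n<N. f n" s "\<lambda>N. 2 * N"]
    unfolding sums_def by (intro tendsto_diff tendsto_mult_left) (auto simp: strict_mono_def o_def)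
  moreover have "(\<Sum>n<2 * N. f n) - c * (\<Sum>n<N. f n) = (\<Sum>n<N. f (2 * n))" for N
    by (induction N) (use odd in \<open>simp_all add: algebra_simps\<close>)
  ultimately show ?thesis by (simp add: sums_def algebra_simps)
qed

lemma inverse_plus_half_squares_sums: "(\<lambda>m. 1 / plus_half m ^ 2) sums (pi ^ 2 / 2)"
proof -
  have "(\<lambda>m. 1 / real (2 * m + 1) ^ 2) sums ((1 - 1 / 4) * (pi\<^sup>2 / 6))"
    using sums_even_indices[OF inverse_squares_sums, of "1/4"]
    by (simp add: field_simps power2_eq_square)
  from sums_mult[OF this, of 4] show ?thesis by (simp add: field_simps power2_eq_square)
qed

lemma riemann_zeta_3_sums: "(\<lambda>n. 1 / real (Suc n) ^ 3) sums riemann_zeta 3"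
proof -
  have "riemann_zeta 3 = (\<Sum>n. 1 / real (Suc n) ^ 3)"
    by (simp add: riemann_zeta_def powr_numeral del: of_nat_Suc)
  moreover have "summable (\<lambda>n. 1 / real (Suc n) ^ 3)"
    using inverse_power_summable[of 3, where 'a = real]
    by (subst summable_Suc_iff) (simp add: inverse_eq_divide power_one_over)
  ultimately show ?thesis by (simp add: summable_sums)
qed

lemma inverse_plus_half_cubes_sums: "(\<lambda>m. 1 / plus_half m ^ 3) sums (7 * riemann_zeta 3)"
proof -
  have "(\<lambda>m. 1 / real (2 * m + 1) ^ 3) sums ((1 - 1 / 8) * riemann_zeta 3)"
    using sums_even_indices[OF riemann_zeta_3_sums, of "1/8"]
    by (simp add: field_simps power3_eq_cube)
  from sums_mult[OF this, of 8] show ?thesis by (simp add: field_simps power3_eq_cube)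
qed

section \<open>Harmonic numbers weighted by half-integer squares\<close>

text \<open>
  A finite form of an Euler type evaluation. Write \<open>b = m + 1/2\<close>. Passing from \<open>N\<close> to \<open>N + 1\<close> changes
  each old summand on the right by \<open>1 / (N - m) - 1 / (N + 1/2)\<close> over \<open>b\<^sup>2\<close>. As \<open>N + 1/2\<close> is the sum of
  \<open>b\<close> and \<open>N - m\<close>, this is \<open>1 / b + 1 / (N - m)\<close> over \<open>(N + 1/2)\<^sup>2\<close>, which has no
  square of \<open>b\<close> left in a denominator, and the sum over \<open>m\<close> collapses to harmonic numbers.
\<close>
lemma reflection_identity:
  "(\<Sum>m<N. (harm m - 1 / plus_half m) / plus_half m ^ 2)
    = (\<Sum>m<N. (harm (N - 1 - m) - (\<Sum>i<N. 1 / plus_half i)) / plus_half m ^ 2)"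
proof (induction N)
  case 0
  show ?case by simp
next
  case (Suc N)
  define S where "S = (\<Sum>i<N. 1 / plus_half i)"
  have row: "(harm (N - m) - (S + 1 / plus_half N)) / plus_half m ^ 2
      = (harm (N - 1 - m) - S) / plus_half m ^ 2
        + (1 / plus_half m + 1 / (real N - real m)) / plus_half N ^ 2"
    if "m < N" for m
  proof -
    have "harm (N - m) = harm (N - 1 - m) + 1 / (real N - real m)"
      using that harm_Suc[of "N - 1 - m", where 'a = real]
      by (simp add: of_nat_diff inverse_eq_divide Suc_diff_Suc)
    moreover define d where "d = real N - real m"
    moreover have "(1 / d - 1 / plus_half N) / plus_half m ^ 2
        = (1 / plus_half m + 1 / d) / plus_half N ^ 2"
    proof -
      have "d > 0" "plus_half m > 0" "plus_half N > 0" using that by (auto simp: d_def)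
      moreover have "plus_half N = plus_half m + d" by (simp add: d_def)
      moreover have "(1 / d - 1 / c) / b ^ 2 = (1 / b + 1 / d) / c ^ 2"
        if "d > 0" "b > 0" "c > 0" "c = b + d" for b c d :: real
        using that by (simp add: divide_simps) (simp add: algebra_simps power2_eq_square)
      ultimately show ?thesis by blast
    qed
    ultimately show ?thesis by (simp add: diff_divide_distrib add_divide_distrib)
  qed
  have "(\<Sum>m<Suc N. (harm (Suc N - 1 - m) - (\<Sum>i<Suc N. 1 / plus_half i)) / plus_half m ^ 2)
      = (\<Sum>m<N. (harm (N - m) - (S + 1 / plus_half N)) / plus_half m ^ 2)
        + (0 - (S + 1 / plus_half N)) / plus_half N ^ 2"
    by (simp add: S_def harm_expand)
  also have "(\<Sum>m<N. (harm (N - m) - (S + 1 / plus_half N)) / plus_half m ^ 2)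
      = (\<Sum>m<N. (harm (N - 1 - m) - S) / plus_half m ^ 2) + (S + harm N) / plus_half N ^ 2"
  proof -
    have "(\<Sum>m<N. (harm (N - m) - (S + 1 / plus_half N)) / plus_half m ^ 2)
      = (\<Sum>m<N. (harm (N - 1 - m) - S) / plus_half m ^ 2
          + (1 / plus_half m + 1 / (real N - real m)) / plus_half N ^ 2)"
      by (rule sum.cong) (use row in auto)
    also have "\<dots> = (\<Sum>m<N. (harm (N - 1 - m) - S) / plus_half m ^ 2)
        + ((\<Sum>m<N. 1 / plus_half m) + (\<Sum>m<N. 1 / (real N - real m))) / plus_half N ^ 2"
      by (simp only: sum.distrib flip: sum_divide_distrib)
    finally show ?thesis by (simp only: sum_inverse_reversed S_def)
  qed
  finally show ?case
    using Suc.IH by (simp add: S_def diff_divide_distrib add_divide_distrib)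
qed

text \<open>
  For fixed \<open>m\<close> the numerator tends to \<open>- 2 ln 2\<close>, since \<open>harm N - (2 harm (2 N) - harm N)\<close> does; the
  weights \<open>1 / (m + 1/2)\<^sup>2\<close> add up to \<open>\<pi>\<^sup>2 / 2\<close>. The error of replacing \<open>harm (N - 1 - m)\<close> by
  \<open>harm N\<close> is at most \<open>(m + 1) / (N - m)\<close> per numerator, hence \<open>8 harm N / (N + 1)\<close> in total by
  partial fractions.
\<close>
lemma reflected_sum_tendsto:
  "(\<lambda>N. \<Sum>m<N. (harm (N - 1 - m) - (\<Sum>i<N. 1 / plus_half i)) / plus_half m ^ 2)
     \<longlonglongrightarrow> - (pi ^ 2 * ln 2)"
proof -
  define T where "T N = (\<Sum>m<N. (harm N - harm (N - 1 - m)) / plus_half m ^ 2)" for N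
  have "(\<lambda>N. 8 * (harm N / real N) * (real N / (real N + 1))) \<longlonglongrightarrow> 0"
  proof -
    have "(\<lambda>N. real N / (real N + 1)) \<longlonglongrightarrow> 1" by real_asymp
    hence "(\<lambda>N. 8 * (harm N / real N) * (real N / (real N + 1))) \<longlonglongrightarrow> 8 * 0 * 1"
      by (intro tendsto_mult tendsto_const harm_over_n_tendsto_0)
    thus ?thesis by simp
  qed
  moreover have "norm (T N) \<le> norm (8 * (harm N / real N) * (real N / (real N + 1))) * 1" for N
  proof -
    have "0 \<le> T N"
      unfolding T_def by (intro sum_nonneg divide_nonneg_nonneg) (auto intro: harm_mono)
    moreover have "T N \<le> (\<Sum>m<N. 4 / (real N + 1) * (1 / (real m + 1) + 1 / (real N - real m)))"
      unfolding T_def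
    proof (rule sum_mono)
      fix m assume "m \<in> {..<N}"
      hence m: "real N - real m > 0" "m < N" by auto
      \<comment> \<open>Bounding \<open>m + 1/2\<close> below by \<open>(m + 1) / 2\<close> lets one factor \<open>m + 1\<close> cancel.\<close>
      have "(harm N - harm (N - 1 - m)) / plus_half m ^ 2
          \<le> (real (m + 1) / (real N - real m)) / ((real m + 1) / 2) ^ 2"
        using harm_diff_le [OF m(2)] m(1) by (intro frac_le power_mono) auto
      also have "\<dots> = 4 / (real N + 1) * (1 / (real m + 1) + 1 / (real N - real m))"
      proof -
        have "q / p / (q / 2) ^ 2 = 4 / (p + q) * (1 / q + 1 / p)" if "p > 0" "q > 0" for p q :: real
          using that by (simp add: divide_simps) (simp add: algebra_simps power2_eq_square)
        from this [OF m(1), of "real m + 1"] show ?thesis by (simp add: add.commute)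
      qed
      finally show "(harm N - harm (N - 1 - m)) / plus_half m ^ 2
          \<le> 4 / (real N + 1) * (1 / (real m + 1) + 1 / (real N - real m))" .
    qed
    moreover have "\<dots> = 8 * harm N / (real N + 1)"
      by (simp only: sum.distrib sum_inverse_Suc sum_inverse_reversed flip: sum_distrib_left) simp
    moreover have "\<dots> = 8 * (harm N / real N) * (real N / (real N + 1))"
      by (cases "N = 0") (auto simp: harm_expand)
    moreover have "0 \<le> 8 * (harm N / real N) * (real N / (real N + 1))"
      by (simp add: harm_nonneg)
    ultimately show ?thesis unfolding real_norm_def by linarith
  qed
  ultimately have T: "T \<longlonglongrightarrow> 0"
    by (rule tendsto_0_le [OF _ eventuallyI])
  have "(\<lambda>N. - 2 * (harm (2 * N) - harm N) * (\<Sum>m<N. 1 / plus_half m ^ 2) - T N)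
      \<longlonglongrightarrow> - 2 * ln 2 * (pi ^ 2 / 2) - 0"
    by (intro tendsto_diff tendsto_mult tendsto_const harm_double_diff_tendsto T
        inverse_plus_half_squares_sums [unfolded sums_def])
  moreover have "- 2 * (harm (2 * N) - harm N) * (\<Sum>m<N. 1 / plus_half m ^ 2) - T N
      = (\<Sum>m<N. (harm (N - 1 - m) - (\<Sum>i<N. 1 / plus_half i)) / plus_half m ^ 2)" for N
    unfolding T_def sum_inverse_plus_half sum_distrib_left sum_subtractf [symmetric]
    by (intro sum.cong) (auto simp: diff_divide_distrib add_divide_distrib algebra_simps)
  ultimately show ?thesis by (simp add: mult.commute)
qed

section \<open>A differentiated Wilf-Zeilberger pair\<close>

text \<open>
  With \<open>x = j + 1/2\<close> this is \<open>(-1)\<^sup>j K(m, x) / \<pi>\<close> for the kernel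
  \<open>K(m, x) = \<Gamma>(x)\<^sup>2 \<Gamma>(m + 1) / \<Gamma>(m + 2 x)\<close>.
\<close>
definition wz_kernel :: "nat \<Rightarrow> nat \<Rightarrow> real" where
  "wz_kernel m j = real ((2 * j) choose j) / ((- 16) ^ j * real ((m + 2 * j) choose m))"

text \<open>
  Half the logarithmic derivative of \<open>K(m, x)\<close> in \<open>x\<close>, which is \<open>\<psi>(x) - \<psi>(m + 2 x)\<close>, increased by
  the constant \<open>2 ln 2\<close> (using \<open>\<psi>(j + 1/2) = 2 harm (2 j) - harm j - \<gamma> - 2 ln 2\<close>). A constant shift is
  harmless: it adds to the differentiated pair a multiple of the undifferentiated one, for which the
  same relation holds. At \<open>m = 0\<close> the shifted value is \<open>harm (2 j) - harm j\<close>.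
\<close>
definition wz_kernel_slope :: "nat \<Rightarrow> nat \<Rightarrow> real" where
  "wz_kernel_slope m j = 2 * harm (2 * j) - harm j - harm (m + 2 * j)"

text \<open>
  Half the \<open>x\<close>-derivative of \<open>K(m, x) / (m + x)\<^sup>2\<close> in the above normalisation.
\<close>
definition wz_F :: "nat \<Rightarrow> nat \<Rightarrow> real" where
  "wz_F m j = wz_kernel m j * (wz_kernel_slope m j / (real m + real j + 1 / 2) ^ 2
      - 1 / (real m + real j + 1 / 2) ^ 3)"

text \<open>
  Half the \<open>x\<close>-derivative of \<open>K(m, x) / (2 x (m + 2 x))\<close> in the above normalisation.
\<close>
definition wz_G :: "nat \<Rightarrow> nat \<Rightarrow> real" where
  "wz_G m j = wz_kernel m j / ((2 * real j + 1) * (real m + 2 * real j + 1))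
      * (wz_kernel_slope m j - 1 / (2 * real j + 1) - 1 / (real m + 2 * real j + 1))"

text \<open>
  In factorial form both index shifts of the kernel are visibly rational.
\<close>
lemma wz_kernel_fact:
  "wz_kernel m j = (fact (2 * j) / (4 ^ j * fact j)) ^ 2 * fact m / ((- 1) ^ j * fact (m + 2 * j))"
proof -
  have "(- 16 :: real) ^ j = (- 1) ^ j * (4 ^ j) ^ 2"
    by (simp add: power_mult_distrib [symmetric] flip: power_mult power_mult_distrib)
       (simp add: power_mult mult.commute [of j] flip: power_mult_distrib)
  thus ?thesis
    by (simp add: wz_kernel_def binomial_fact power2_eq_square divide_simps)
qed

lemma wz_kernel_Suc_m:
  "wz_kernel (Suc m) j = wz_kernel m j * (real m + 1) / (real m + 2 * real j + 1)"
  by (simp add: wz_kernel_fact add.commute mult.assoc mult.left_commute mult.commute)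

lemma wz_kernel_Suc_j:
  "wz_kernel m (Suc j) = - wz_kernel m j * (real j + 1 / 2) ^ 2
     / ((real m + 2 * real j + 1) * (real m + 2 * real j + 2))"
proof -
  have "(fact (2 * Suc j) / (4 ^ Suc j * fact (Suc j)) :: real)
      = fact (2 * j) / (4 ^ j * fact j) * (real j + 1 / 2)"
    by (simp add: divide_simps) (simp add: algebra_simps)
  moreover have "(fact (m + 2 * Suc j) :: real)
      = fact (m + 2 * j) * ((real m + 2 * real j + 1) * (real m + 2 * real j + 2))"
    by (simp add: algebra_simps)
  ultimately show ?thesis
    by (simp only: wz_kernel_fact power_mult_distrib) (simp add: mult.assoc mult.left_commute)
qed

lemma wz_kernel_slope_Suc_m:
  "wz_kernel_slope (Suc m) j = wz_kernel_slope m j - 1 / (real m + 2 * real j + 1)"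
  by (simp add: wz_kernel_slope_def harm_Suc inverse_eq_divide add.commute)

lemma wz_kernel_slope_Suc_j:
  "wz_kernel_slope m (Suc j) = wz_kernel_slope m j + 2 / (2 * real j + 1)
     - 1 / (real m + 2 * real j + 1) - 1 / (real m + 2 * real j + 2)"
proof -
  have "2 / (2 + 2 * real j) = 1 / (1 + real j)"
    by (simp add: divide_simps)
  thus ?thesis
    by (simp add: wz_kernel_slope_def harm_Suc inverse_eq_divide add.commute)
qed

text \<open>
  The rational identity behind the differentiated pair, with \<open>s = m + 2 x\<close>, \<open>t = m + 1 + x\<close>, \<open>w\<close> for
  the kernel and \<open>L\<close> for its slope. The coefficient of \<open>L\<close> is the undifferentiated relation, which comes
  down to \<open>(m + 1) (m + 1 + 2 x) + x\<^sup>2 = (m + 1 + x)\<^sup>2\<close>; the same square also cancels the terms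
  free of \<open>L\<close>.
\<close>
lemma wz_relation_algebra:
  fixes w x s L :: real
  assumes x: "x > 0" and s: "s > 0" and t: "t = s + 1 - x" "t > 0"
  shows "- w * x ^ 2 / (s * (s + 1)) *
       ((L + 1 / x - 1 / s - 1 / (s + 1)) / t ^ 2 - 1 / t ^ 3)
     - w * (s + 1 - 2 * x) / s * ((L - 1 / s) / t ^ 2 - 1 / t ^ 3)
   = w * (s + 1 - 2 * x) / s / (2 * x * (s + 1)) * (L - 1 / s - 1 / (2 * x) - 1 / (s + 1))
     - w / (2 * x * s) * (L - 1 / (2 * x) - 1 / s)" (is "?lhs = ?rhs")
proof -
  define p where "p = s + 1"
  define K where "K = L - 1 / s"
  define f where "f = w / (s * p)"
  have p: "p > 0" using s by (simp add: p_def)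
  have sq: "(p - 2 * x) * p + x ^ 2 = t ^ 2"
    by (simp add: t p_def power2_eq_square algebra_simps)
  have "?lhs = - f * (((p - 2 * x) * p + x ^ 2) * (K / t ^ 2 - 1 / t ^ 3)
                        + (x - x ^ 2 / p) / t ^ 2)"
    using x s p t(2) unfolding f_def K_def p_def [symmetric]
    by (simp add: field_simps power2_eq_square power3_eq_cube)
  also have "\<dots> = - f * (K - (p * t - (p - x) * x) / (p * t ^ 2))"
    unfolding sq using t(2) p by (simp add: field_simps power2_eq_square power3_eq_cube)
  also have "p * t - (p - x) * x = t ^ 2"
    by (simp add: t p_def power2_eq_square algebra_simps)
  also have "- f * (K - t ^ 2 / (p * t ^ 2)) = - f * (K - 1 / p)"
    using t(2) by simp
  also have "\<dots> = ?rhs"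
    using x s p unfolding f_def K_def p_def [symmetric]
    by (simp add: field_simps power2_eq_square)
  finally show ?thesis .
qed

lemma wz_relation: "wz_F m (Suc j) - wz_F (Suc m) j = wz_G (Suc m) j - wz_G m j"
proof -
  define x where "x = real j + 1 / 2"
  define s where "s = real m + 2 * x"
  define t where "t = s + 1 - x"
  have pos: "x > 0" "s > 0" "t > 0" by (auto simp: x_def s_def t_def)
  have eqs: "2 * real j + 1 = 2 * x" "real j + 1 / 2 = x" "real m + 2 * real j + 1 = s"
    "real m + 2 * real j + 2 = s + 1" "real m + real (Suc j) + 1 / 2 = t"
    "real (Suc m) + real j + 1 / 2 = t" "real (Suc m) + 2 * real j + 1 = s + 1"
    "real m + 1 = s + 1 - 2 * x" "2 / (2 * x) = 1 / x"
    using pos(1) by (auto simp: x_def s_def t_def divide_simps)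
  show ?thesis
    using wz_relation_algebra [OF pos(1,2) t_def pos(3), of "wz_kernel m j" "wz_kernel_slope m j"]
    by (simp only: wz_F_def wz_G_def wz_kernel_Suc_m wz_kernel_Suc_j
        wz_kernel_slope_Suc_m wz_kernel_slope_Suc_j eqs)
qed

section \<open>Exchanging the directions of summation\<close>

lemma abs_wz_kernel:
  "\<bar>wz_kernel m j\<bar> = real ((2 * j) choose j) / (16 ^ j * real ((m + 2 * j) choose m))"
  by (simp add: wz_kernel_def abs_mult power_abs)

text \<open>
  The factor \<open>(1 / 4)\<^sup>j\<close> comes from \<open>(2 j choose j) \<le> 4\<^sup>j\<close>. Keeping a lower bound \<open>b\<close> of the other
  binomial coefficient allows \<open>b = 1\<close> in general and \<open>b = m + 1\<close> for \<open>j > 0\<close>; the latter provides the decay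
  in \<open>m\<close> that makes up for a linear bound on the harmonic numbers.
\<close>
lemma abs_wz_kernel_le:
  assumes "real b \<le> real ((m + 2 * j) choose m)" "b > 0"
  shows "\<bar>wz_kernel m j\<bar> \<le> (1 / 4) ^ j / real b"
proof -
  have "real ((2 * j) choose j) \<le> 4 ^ j"
    using binomial_le_pow2 [of "2 * j" j] by (simp add: power_mult flip: of_nat_le_iff)
  hence "\<bar>wz_kernel m j\<bar> \<le> 4 ^ j / (16 ^ j * real b)"
    unfolding abs_wz_kernel using assms by (intro frac_le mult_left_mono) auto
  also have "(16 :: real) ^ j = 4 ^ j * 4 ^ j"
    by (simp flip: power_mult_distrib)
  also have "4 ^ j / (4 ^ j * 4 ^ j * real b) = (1 / 4) ^ j / real b"
    by (simp add: power_divide)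
  finally show ?thesis .
qed

lemma abs_wz_kernel_le_1: "\<bar>wz_kernel m j\<bar> \<le> 1"
proof -
  have "\<bar>wz_kernel m j\<bar> \<le> (1 / 4) ^ j / real 1"
    by (rule abs_wz_kernel_le) (simp_all add: Suc_le_eq)
  also have "\<dots> \<le> 1" by (simp add: power_le_one)
  finally show ?thesis .
qed

lemma wz_kernel_slope_bounds:
  "- harm (m + 2 * j) \<le> wz_kernel_slope m j"
  "wz_kernel_slope m j \<le> 2 * harm (2 * j)"
  using harm_mono [of j "2 * j", where 'a = real] harm_nonneg [of j, where 'a = real]
    harm_nonneg [of "2 * j", where 'a = real] harm_nonneg [of "m + 2 * j", where 'a = real]
  by (simp_all add: wz_kernel_slope_def)

text \<open>
  The slope is at most linear in \<open>m + j\<close>, so one of the two powers of \<open>m + j + 1/2\<close> in the denominator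
  survives; the kernel supplies another factor \<open>1 / (m + 1)\<close>. The result is summable in \<open>m\<close>, with a total
  that vanishes as \<open>j\<close> grows.
\<close>
lemma abs_wz_F_le:
  assumes "j > 0"
  shows "\<bar>wz_F m j\<bar> \<le> 4 * (1 / 4) ^ j * (1 / (real m + 1 / 2) ^ 2)"
proof -
  define y where "y = real m + real j + 1 / 2"
  have y: "y \<ge> real m + 1 / 2" "y > 0" by (simp_all add: y_def)
  have "Suc m \<le> (m + 2 * j) choose m"
    using binomial_right_mono [of "Suc m" "m + 2 * j" m] assms by simp
  hence w: "\<bar>wz_kernel m j\<bar> \<le> (1 / 4) ^ j / real (Suc m)"
    by (intro abs_wz_kernel_le) auto
  have "\<bar>wz_kernel_slope m j\<bar> \<le> 4 * (real m + real j)"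
    using wz_kernel_slope_bounds [of m j] harm_le_self [of "m + 2 * j"] harm_le_self [of "2 * j"] by simp
  moreover have "0 \<le> 1 / y" "1 / y \<le> 2" using y by (auto simp: divide_simps y_def)
  moreover have "4 * y = 4 * (real m + real j) + 2" by (simp add: y_def)
  ultimately have "\<bar>wz_kernel_slope m j - 1 / y\<bar> \<le> 4 * y"
    by linarith
  hence "\<bar>wz_kernel_slope m j - 1 / y\<bar> / y ^ 2 \<le> 4 / y"
    using y(2) by (simp add: divide_simps power2_eq_square)
  moreover have "wz_kernel_slope m j / y ^ 2 - 1 / y ^ 3 = (wz_kernel_slope m j - 1 / y) / y ^ 2"
    by (simp add: diff_divide_distrib power2_eq_square power3_eq_cube)
  ultimately have "\<bar>wz_kernel_slope m j / y ^ 2 - 1 / y ^ 3\<bar> \<le> 4 / y"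
    by (simp add: abs_divide)
  hence "\<bar>wz_F m j\<bar> \<le> (1 / 4) ^ j / real (Suc m) * (4 / y)"
    unfolding wz_F_def y_def [symmetric] abs_mult using w y(2) by (intro mult_mono) auto
  also have "\<dots> \<le> (1 / 4) ^ j / (real m + 1 / 2) * (4 / (real m + 1 / 2))"
    using y by (intro mult_mono frac_le divide_left_mono) auto
  finally show ?thesis by (simp add: power2_eq_square field_simps)
qed

text \<open>
  For fixed \<open>j\<close> the kernel is bounded and the slope grows like a harmonic number, while the remaining
  rational factors decay like \<open>1 / m\<close>.
\<close>
lemma wz_F_plus_G_tendsto_0:
  "(\<lambda>m. wz_F m j + wz_G m j) \<longlonglongrightarrow> 0"
proof -
  define q where "q m = wz_kernel_slope m j / (real m + 2 * real j + 1)" for m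
  have q: "q \<longlonglongrightarrow> 0"
  proof -
    have "(\<lambda>m. harm (m + 2 * j) / real (m + 2 * j)) \<longlonglongrightarrow> 0"
      by (rule LIMSEQ_ignore_initial_segment [OF harm_over_n_tendsto_0])
    moreover have "(\<lambda>m. real (m + 2 * j) / (real m + 2 * real j + 1)) \<longlonglongrightarrow> 1"
      "(\<lambda>m. (2 * harm (2 * j) - harm j) / (real m + 2 * real j + 1)) \<longlonglongrightarrow> 0"
      by real_asymp+
    ultimately have "(\<lambda>m. (2 * harm (2 * j) - harm j) / (real m + 2 * real j + 1)
       - harm (m + 2 * j) / real (m + 2 * j) * (real (m + 2 * j) / (real m + 2 * real j + 1)))
       \<longlonglongrightarrow> 0 - 0 * 1"
      by (intro tendsto_diff tendsto_mult)
    moreover have "(2 * harm (2 * j) - harm j) / (real m + 2 * real j + 1)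
       - harm (m + 2 * j) / real (m + 2 * j) * (real (m + 2 * j) / (real m + 2 * real j + 1)) = q m" for m
      by (cases "m + 2 * j = 0") (auto simp: q_def wz_kernel_slope_def diff_divide_distrib harm_expand)
    ultimately show ?thesis by simp
  qed
  \<comment> \<open>The sum divided by the kernel, arranged so that the slope only occurs in \<open>q\<close>.\<close>
  define r where "r m = q m * ((real m + 2 * real j + 1) / (real m + real j + 1 / 2) ^ 2)
     - 1 / (real m + real j + 1 / 2) ^ 3
     + (q m - 1 / (2 * real j + 1) * (1 / (real m + 2 * real j + 1))
        - 1 / (real m + 2 * real j + 1) ^ 2) / (2 * real j + 1)" for m
  have "r \<longlonglongrightarrow> 0 * 0 - 0 + (0 - 1 / (2 * real j + 1) * 0 - 0) / (2 * real j + 1)"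
    unfolding r_def
    by (intro tendsto_add tendsto_diff tendsto_mult tendsto_divide tendsto_const q) (real_asymp | simp)+
  hence "r \<longlonglongrightarrow> 0" by simp
  moreover have "norm (wz_F m j + wz_G m j) \<le> norm (r m) * 1" for m
  proof -
    have "wz_kernel m j / (c * p) * (wz_kernel_slope m j - 1 / c - 1 / p)
        = wz_kernel m j * ((wz_kernel_slope m j / p - 1 / c * (1 / p) - 1 / p ^ 2) / c)" for c p
      by (simp add: diff_divide_distrib right_diff_distrib power2_eq_square mult_ac)
    moreover have "wz_kernel_slope m j / (real m + 2 * real j + 1) * ((real m + 2 * real j + 1) / y)
        = wz_kernel_slope m j / y" for y
      by simp
    ultimately have "wz_F m j + wz_G m j = wz_kernel m j * r m"
      by (simp only: wz_F_def wz_G_def r_def q_def distrib_left [of "wz_kernel m j"])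
    thus ?thesis
      using mult_right_mono [OF abs_wz_kernel_le_1, of "\<bar>r m\<bar>" m j] by (simp add: abs_mult)
  qed
  ultimately show ?thesis by (rule tendsto_0_le [OF _ eventuallyI])
qed

text \<open>
  Since \<open>wz_F m (Suc j) - wz_F m j\<close> is the \<open>m\<close>-difference of \<open>wz_F + wz_G\<close>, summing it over a rectangle
  leaves only the four sides.
\<close>
lemma wz_rectangle_sum:
  "(\<Sum>m<M. wz_F m J) = (\<Sum>m<M. wz_F m 0)
     + (\<Sum>j<J. (wz_F M j + wz_G M j) - (wz_F 0 j + wz_G 0 j))"
proof (induction J)
  case (Suc J)
  have "(\<Sum>m<M. wz_F m (Suc J) - wz_F m J)
      = (\<Sum>m<M. (wz_F (Suc m) J + wz_G (Suc m) J) - (wz_F m J + wz_G m J))"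
    using wz_relation [of _ J] by (intro sum.cong) (auto simp: algebra_simps)
  also have "\<dots> = (wz_F M J + wz_G M J) - (wz_F 0 J + wz_G 0 J)"
    by (rule sum_lessThan_telescope)
  finally show ?case using Suc by (simp add: sum_subtractf)
qed simp

text \<open>
  In the rectangle identity the side at \<open>m = M\<close> vanishes for \<open>M \<rightarrow> \<infinity>\<close> and the side at \<open>j = J\<close> then vanishes
  for \<open>J \<rightarrow> \<infinity>\<close>. The two remaining sides have equal sums.
\<close>
lemma wz_edge_sums:
  assumes row: "(\<lambda>m. wz_F m 0) sums L"
  shows "(\<lambda>j. wz_F 0 j + wz_G 0 j) sums L"
proof -
  define E where "E j = wz_F 0 j + wz_G 0 j" for j
  have bound: "\<bar>(\<Sum>j<J. E j) - L\<bar> \<le> 4 * (1 / 4) ^ J * (pi ^ 2 / 2)" if "J > 0" for J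
  proof -
    have "(\<lambda>M. (\<Sum>m<M. wz_F m 0) + (\<Sum>j<J. (wz_F M j + wz_G M j) - E j))
        \<longlonglongrightarrow> L + (\<Sum>j<J. 0 - E j)"
      using row unfolding sums_def
      by (intro tendsto_add tendsto_sum tendsto_diff wz_F_plus_G_tendsto_0 tendsto_const)
    hence "(\<lambda>M. \<Sum>m<M. wz_F m J) \<longlonglongrightarrow> L - (\<Sum>j<J. E j)"
      by (simp only: E_def wz_rectangle_sum [symmetric] diff_0 sum_negf add_uminus_conv_diff)
    hence lim: "(\<lambda>M. \<bar>\<Sum>m<M. wz_F m J\<bar>) \<longlonglongrightarrow> \<bar>L - (\<Sum>j<J. E j)\<bar>"
      by (rule tendsto_rabs)
    have "\<bar>\<Sum>m<M. wz_F m J\<bar> \<le> 4 * (1 / 4) ^ J * (pi ^ 2 / 2)" for M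
    proof -
      have "\<bar>\<Sum>m<M. wz_F m J\<bar> \<le> (\<Sum>m<M. 4 * (1 / 4) ^ J * (1 / (real m + 1 / 2) ^ 2))"
        by (rule order.trans [OF sum_abs sum_mono [OF abs_wz_F_le [OF that]]])
      also have "\<dots> \<le> 4 * (1 / 4) ^ J * (pi ^ 2 / 2)"
        using sum_le_suminf [OF sums_summable [OF sums_mult [OF inverse_plus_half_squares_sums]],
            of "{..<M}" "4 * (1 / 4) ^ J"]
        unfolding sums_unique [OF sums_mult [OF inverse_plus_half_squares_sums], symmetric] by simp
      finally show ?thesis .
    qed
    thus ?thesis
      using LIMSEQ_le_const2 [OF lim] by (simp add: abs_minus_commute)
  qed
  have "(\<lambda>J. 4 * (1 / 4) ^ J * (pi ^ 2 / 2)) \<longlonglongrightarrow> 0" by real_asymp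
  hence "(\<lambda>J. (\<Sum>j<J. E j) - L) \<longlonglongrightarrow> 0"
    by (rule Lim_null_comparison [rotated])
      (use bound in \<open>auto intro!: eventually_mono [OF eventually_gt_at_top [of 0]]\<close>)
  thus ?thesis by (simp add: sums_def E_def LIM_zero_iff)
qed

text \<open>
  With \<open>b = m + 1/2\<close> the summand is \<open>- harm m / b\<^sup>2 - 1 / b\<^sup>3\<close>. The reflection identity evaluates
  \<open>harm m / b\<^sup>2 - 1 / b\<^sup>3\<close>, which leaves \<open>-2 / b\<^sup>3\<close> to be summed by \<open>\<zeta>(3)\<close>.
\<close>
lemma wz_F_row_sums: "(\<lambda>m. wz_F m 0) sums (pi ^ 2 * ln 2 - 14 * riemann_zeta 3)"
proof -
  have "(\<lambda>m. (harm m - 1 / plus_half m) / plus_half m ^ 2) sums (- (pi ^ 2 * ln 2))"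
    using reflected_sum_tendsto unfolding sums_def reflection_identity .
  from sums_diff [OF sums_minus [OF this] sums_mult [OF inverse_plus_half_cubes_sums, of 2]]
  have "(\<lambda>m. - ((harm m - 1 / plus_half m) / plus_half m ^ 2) - 2 * (1 / plus_half m ^ 3))
      sums (pi ^ 2 * ln 2 - 14 * riemann_zeta 3)"
    by simp
  moreover have "wz_F m 0 = - ((harm m - 1 / plus_half m) / plus_half m ^ 2) - 2 * (1 / plus_half m ^ 3)"
    for m
    by (simp add: wz_F_def wz_kernel_def wz_kernel_slope_def harm_expand diff_divide_distrib
        power2_eq_square power3_eq_cube)
  ultimately show ?thesis by simp
qed

section \<open>Reduction of the series by telescoping\<close>

lemma wz_kernel_0: "wz_kernel 0 k = real ((2 * k) choose k) / (- 16) ^ k"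
  by (simp add: wz_kernel_def)

lemma wz_edge_eq:
  "wz_F 0 k + wz_G 0 k = 5 * (real ((2 * k) choose k) / (- 16) ^ k *
     ((harm (2 * k) - harm k) / (2 * real k + 1) ^ 2 - 2 / (2 * real k + 1) ^ 3))"
proof -
  define c where "c = 2 * real k + 1"
  have c: "c > 0" "real k + 1 / 2 = c / 2" by (simp_all add: c_def)
  have "D / (c / 2) ^ 2 - 1 / (c / 2) ^ 3 + 1 / (c * c) * (D - 1 / c - 1 / c)
      = 5 * (D / c ^ 2 - 2 / c ^ 3)" for D
    using c(1) by (simp add: power_divide divide_simps) (simp add: algebra_simps eval_nat_numeral)
  note * = this [of "harm (2 * k) - harm k"]
  have "wz_F 0 k + wz_G 0 k = wz_kernel 0 k * (wz_kernel_slope 0 k / (c / 2) ^ 2 - 1 / (c / 2) ^ 3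
      + 1 / (c * c) * (wz_kernel_slope 0 k - 1 / c - 1 / c))"
    by (simp add: wz_F_def wz_G_def c(2) distrib_left flip: c_def)
  moreover have "wz_kernel_slope 0 k = harm (2 * k) - harm k" by (simp add: wz_kernel_slope_def)
  ultimately show ?thesis using * by (simp add: wz_kernel_def flip: c_def)
qed

text \<open>
  Half the derivative in \<open>k\<close> of \<open>binomial(2 k, k) k (2 k + 3) / (2 (2 k + 1)\<^sup>4)\<close>, times \<open>(-16)\<^sup>-\<^sup>k\<close>. It is
  obtained by solving \<open>P / (c\<^sup>4 d\<^sup>4) = 5 / (16 c\<^sup>2) + \<Delta>\<close> with \<open>P = 20 k\<^sup>2 + 44 k + 25\<close>,
  \<open>c = 2 k + 1\<close>, \<open>d = 2 k + 3\<close>, up to the common factor \<open>binomial(2 k, k) (-16)\<^sup>-\<^sup>k\<close>, for a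
  difference \<open>\<Delta>\<close> of hypergeometric terms, and then differentiating. The term before differentiation vanishes
  at \<open>k = 0\<close>, but its derivative does not.
\<close>
definition telescoper :: "nat \<Rightarrow> real" where
  "telescoper k = wz_kernel 0 k / (2 * real k + 1) ^ 4 *
     (real k * (2 * real k + 3) / 2 * (harm (2 * k) - harm k)
     + (4 * real k + 3) / 4 - 2 * real k * (2 * real k + 3) / (2 * real k + 1))"

lemma wz_kernel_0_Suc:
  "wz_kernel 0 (Suc k) = - wz_kernel 0 k * (2 * real k + 1) / (8 * (real k + 1))"
proof -
  have "(real k + 1 / 2) ^ 2 / ((2 * real k + 1) * (2 * real k + 2))
      = (2 * real k + 1) / (8 * (real k + 1))"
    by (simp add: divide_simps) (simp add: algebra_simps power2_eq_square)
  thus ?thesis using wz_kernel_Suc_j [of 0 k]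
    by (metis (no_types, lifting) add_0 of_nat_0 times_divide_eq_right)
qed

text \<open>
  The shift of the binomial coefficient has the denominator \<open>k + 1\<close>, which cancels here.
\<close>
lemma telescoper_Suc:
  fixes k :: nat
  defines "c \<equiv> 2 * real k + 1" and "d \<equiv> 2 * real k + 3"
  shows "telescoper (Suc k) = wz_kernel 0 k *
    (- (c * (2 * real k + 5) / (16 * d ^ 4)) * (harm (2 * k) - harm k)
     - 1 / (8 * d ^ 3) + c * (2 * real k + 5) / (4 * d ^ 5))"
proof -
  define x where "x = real k"
  define D where "D = harm (2 * k) - (harm k :: real)"
  have pos: "x + 1 > 0" "c > 0" "d > 0" by (simp_all add: x_def c_def d_def)
  define E where "E = (2 * x + 5) / 2 * D + d / c - 2 * (2 * x + 5) / d"
  have cd: "c = 2 * x + 1" "d = 2 * x + 3" by (simp_all add: x_def c_def d_def)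
  have D: "harm (2 * Suc k) - harm (Suc k) = D + 1 / (c * (2 * (x + 1)))"
  proof -
    define h where "h = 1 / (2 * (x + 1))"
    have h: "1 / (x + 1) = h + h"
      using pos by (simp add: h_def divide_simps)
    have "harm (2 * Suc k) - harm (Suc k) = D + 1 / c + h - 1 / (x + 1)"
      by (simp add: D_def harm_Suc inverse_eq_divide c_def x_def h_def algebra_simps)
    also have "\<dots> = D + (1 / c - h)"
      unfolding h by simp
    also have "1 / c - h = 1 / (c * (2 * (x + 1)))"
      using pos by (simp add: h_def divide_simps) (simp add: cd)
    finally show ?thesis .
  qed
  have "(x + 1) * (2 * x + 5) / 2 * (D + 1 / (c * (2 * (x + 1)))) + (4 * x + 7) / 4
      - 2 * (x + 1) * (2 * x + 5) / d = (x + 1) * E"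
  proof -
    have "(x + 1) * e / 2 * (1 / (c * (2 * (x + 1)))) = e / (4 * c)" for e
      using pos by (simp add: divide_simps)
    moreover have "(2 * x + 5) / (4 * c) + (4 * x + 7) / 4 = (x + 1) * (d / c)"
      using pos by (simp add: divide_simps) (simp add: cd algebra_simps)
    moreover have "y * e / 2 * (D + p) + f - 2 * y * e / d = y * (e / 2 * D + q - 2 * e / d)"
      if "y * e / 2 * p = r" "r + f = y * q" for y e f p q r
    proof -
      have "y * e / 2 * (D + p) = y * e / 2 * D + r" by (simp only: distrib_left that(1))
      moreover have "y * (e / 2 * D + q - 2 * e / d) = y * e / 2 * D + (r + f) - 2 * y * e / d"
        by (simp add: that(2) distrib_left right_diff_distrib)
      ultimately show ?thesis by simp
    qed
    ultimately show ?thesis unfolding E_def by blast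
  qed
  moreover have "telescoper (Suc k) = - wz_kernel 0 k * c / (8 * (x + 1)) / d ^ 4 *
     ((x + 1) * (2 * x + 5) / 2 * (D + 1 / (c * (2 * (x + 1)))) + (4 * x + 7) / 4
      - 2 * (x + 1) * (2 * x + 5) / d)"
  proof -
    have "2 * real (Suc k) + 1 = d" "real (Suc k) = x + 1" "2 * real (Suc k) + 3 = 2 * x + 5"
      "4 * real (Suc k) + 3 = 4 * x + 7"
      by (simp_all add: x_def d_def)
    thus ?thesis
      by (simp only: telescoper_def wz_kernel_0_Suc D) (simp add: c_def x_def)
  qed
  ultimately have "telescoper (Suc k) = - wz_kernel 0 k * c / (8 * (x + 1)) / d ^ 4 * ((x + 1) * E)"
    by simp
  also have "\<dots> = wz_kernel 0 k * ((- c * E) / (8 * d ^ 4))"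
  proof -
    have "- w * c / (8 * y) / d ^ 4 * (y * E) = w * ((- c * E) / (8 * d ^ 4))" if "y > 0" for w y
      using that by simp
    from this [OF pos(1)] show ?thesis .
  qed
  also have "(- c * E) / (8 * d ^ 4)
      = - (c * (2 * x + 5) / (16 * d ^ 4)) * D - 1 / (8 * d ^ 3) + c * (2 * x + 5) / (4 * d ^ 5)"
  proof -
    have "- c * (e / 2 * D + d / c - 2 * e / d)
        = 8 * d ^ 4 * (- (c * e / (16 * d ^ 4)) * D - 1 / (8 * d ^ 3) + c * e / (4 * d ^ 5))" for e
      using pos(2,3) by (simp add: field_simps eval_nat_numeral)
    moreover have "a / q = r" if "a = q * r" "q > 0" for a q r :: real
      using that by simp
    moreover have "8 * d ^ 4 > 0" using pos(3) by simp
    ultimately show ?thesis unfolding E_def by blast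
  qed
  finally show ?thesis by (simp add: x_def D_def)
qed

text \<open>
  The two sides agree separately in the terms with and without \<open>harm (2 k) - harm k\<close>; either comparison
  is an identity of polynomials in \<open>k\<close> after clearing powers of \<open>2 k + 1\<close> and \<open>2 k + 3\<close>.
\<close>
lemma summand_eq:
  "real ((2 * k) choose k) *
        ((20 * real k ^ 2 + 44 * real k + 25) * (harm (2 * k) - harm k)
          - 2 * ((120 * real k ^ 3 + 388 * real k ^ 2 + 434 * real k + 167)
                  / ((2 * real k + 1) * (2 * real k + 3))))
      / ((2 * real k + 1) ^ 4 * (2 * real k + 3) ^ 4 * (- 16) ^ k)
   = (wz_F 0 k + wz_G 0 k) / 16 + (telescoper (Suc k) - telescoper k)" (is "?lhs = ?rhs")
proof -
  define x c d where "x = real k" and "c = 2 * x + 1" and "d = 2 * x + 3"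
  define D where "D = harm (2 * k) - (harm k :: real)"
  define Q where "Q = 120 * x ^ 3 + 388 * x ^ 2 + 434 * x + 167"
  have pos: "c > 0" "d > 0" by (simp_all add: x_def c_def d_def)
  have slope: "(20 * x ^ 2 + 44 * x + 25) / (c ^ 4 * d ^ 4)
      = 5 / (16 * c ^ 2) - c * (2 * x + 5) / (16 * d ^ 4) - x * d / (2 * c ^ 4)"
  proof -
    have "16 * (20 * x ^ 2 + 44 * x + 25) = 5 * c ^ 2 * d ^ 4 - c ^ 5 * (2 * x + 5) - 8 * x * d ^ 5"
      unfolding c_def d_def by (simp add: algebra_simps eval_nat_numeral)
    moreover have "5 * c ^ 2 * d ^ 4 - c ^ 5 * e - 8 * x * d ^ 5
        = (16 * (c ^ 4 * d ^ 4)) * (5 / (16 * c ^ 2) - c * e / (16 * d ^ 4) - x * d / (2 * c ^ 4))" for e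
      using pos by (simp add: field_simps eval_nat_numeral)
    moreover have "P / q = r" if "16 * P = R" "R = (16 * q) * r" "q > 0" for P q r R :: real
      using that by (simp add: field_simps)
    moreover have "c ^ 4 * d ^ 4 > 0" using pos by simp
    ultimately show ?thesis by blast
  qed
  have const: "- 2 * Q / (c ^ 5 * d ^ 5)
      = - 5 / (8 * c ^ 3) - 1 / (8 * d ^ 3) + c * (2 * x + 5) / (4 * d ^ 5)
        - (4 * x + 3) / (4 * c ^ 4) + 2 * x * d / c ^ 5"
  proof -
    have "- 16 * Q = - 5 * c ^ 2 * d ^ 5 - c ^ 5 * d ^ 2 + 2 * c ^ 6 * (2 * x + 5)
        - 2 * (4 * x + 3) * c * d ^ 5 + 16 * x * d ^ 6"
      unfolding c_def d_def Q_def by (simp add: algebra_simps eval_nat_numeral)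
    moreover have "- 5 * c ^ 2 * d ^ 5 - c ^ 5 * d ^ 2 + 2 * c ^ 6 * e - 2 * f * c * d ^ 5 + 16 * x * d ^ 6
        = 8 * (c ^ 5 * d ^ 5) * (- 5 / (8 * c ^ 3) - 1 / (8 * d ^ 3) + c * e / (4 * d ^ 5)
            - f / (4 * c ^ 4) + 2 * x * d / c ^ 5)" for e f
      using pos by (simp add: field_simps eval_nat_numeral)
    moreover have "- 2 * P / q = r" if "- 16 * P = R" "R = 8 * q * r" "q > 0" for P q r R :: real
      using that by (simp add: field_simps)
    moreover have "c ^ 5 * d ^ 5 > 0" using pos by simp
    ultimately show ?thesis by blast
  qed
  have "?lhs = wz_kernel 0 k *
      ((20 * x ^ 2 + 44 * x + 25) / (c ^ 4 * d ^ 4) * D + (- 2 * Q / (c ^ 5 * d ^ 5)))"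
  proof -
    have "b * (P * D - 2 * (Q / (c * d))) / (c ^ 4 * d ^ 4 * s)
        = b / s * (P / (c ^ 4 * d ^ 4) * D + (- 2 * Q / (c ^ 5 * d ^ 5)))" for b P s
    proof -
      have "c ^ 5 * d ^ 5 = c ^ 4 * d ^ 4 * (c * d)" by (simp add: eval_nat_numeral)
      thus ?thesis by (simp add: diff_divide_distrib ring_distribs mult_ac)
    qed
    thus ?thesis
      unfolding wz_kernel_0 x_def c_def d_def D_def Q_def by blast
  qed
  also have "\<dots> = wz_kernel 0 k * (5 * (D / c ^ 2 - 2 / c ^ 3)) / 16
     + (wz_kernel 0 k * (- (c * (2 * x + 5) / (16 * d ^ 4)) * D - 1 / (8 * d ^ 3)
          + c * (2 * x + 5) / (4 * d ^ 5))
        - wz_kernel 0 k * ((x * d / (2 * c ^ 4)) * D + (4 * x + 3) / (4 * c ^ 4) - 2 * x * d / c ^ 5))"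
  proof -
    have "5 * (D / c ^ 2 - 2 / c ^ 3) / 16 = 5 / (16 * c ^ 2) * D - 5 / (8 * c ^ 3)"
      by (simp add: diff_divide_distrib right_diff_distrib)
    moreover have "w * ((s1 - s2 - s3) * D + (- 5 / (8 * c ^ 3) - e1 + e2 - e3 + e4))
        = w * p / 16 + (w * (- s2 * D - e1 + e2) - w * (s3 * D + e3 - e4))"
      if "p / 16 = s1 * D - 5 / (8 * c ^ 3)" for w p s1 s2 s3 e1 e2 e3 e4
    proof -
      have "w * p / 16 = w * (s1 * D - 5 / (8 * c ^ 3))" by (simp flip: that)
      thus ?thesis by (simp add: algebra_simps)
    qed
    ultimately show ?thesis unfolding slope const by blast
  qed
  also have "wz_kernel 0 k * ((x * d / (2 * c ^ 4)) * D + (4 * x + 3) / (4 * c ^ 4) - 2 * x * d / c ^ 5)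
      = telescoper k"
    using pos by (simp add: telescoper_def flip: x_def c_def d_def D_def)
      (simp add: field_simps eval_nat_numeral)
  also have "wz_kernel 0 k * (5 * (D / c ^ 2 - 2 / c ^ 3)) = wz_F 0 k + wz_G 0 k"
    by (simp add: wz_edge_eq wz_kernel_0 x_def c_def D_def)
  finally show ?thesis
    by (simp add: telescoper_Suc x_def c_def d_def D_def)
qed

lemma telescoper_tendsto_0: "telescoper \<longlonglongrightarrow> 0"
proof -
  define r where "r k = real k * (2 * real k + 3) / 2 / (2 * real k + 1) ^ 4 * (harm (2 * k) - harm k)
     + ((4 * real k + 3) / 4 - 2 * real k * (2 * real k + 3) / (2 * real k + 1)) / (2 * real k + 1) ^ 4"
    for k
  have "r \<longlonglongrightarrow> 0 * ln 2 + 0"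
    unfolding r_def
    by (intro tendsto_add tendsto_mult harm_double_diff_tendsto) real_asymp+
  hence "r \<longlonglongrightarrow> 0" by simp
  moreover have "norm (telescoper k) \<le> norm (r k) * 1" for k
  proof -
    have "telescoper k = wz_kernel 0 k * r k"
      by (simp add: telescoper_def r_def wz_kernel_0 add_divide_distrib diff_divide_distrib algebra_simps)
    thus ?thesis
      using mult_right_mono [OF abs_wz_kernel_le_1, of "\<bar>r k\<bar>" 0 k] by (simp add: abs_mult)
  qed
  ultimately show ?thesis by (rule tendsto_0_le [OF _ eventuallyI])
qed

theorem theorem1p18:
  shows "(\<lambda>k::nat.
      real ((2 * k) choose k) *
        ((20 * real k ^ 2 + 44 * real k + 25) * (harm (2 * k) - harm k)
          - 2 * ((120 * real k ^ 3 + 388 * real k ^ 2 + 434 * real k + 167)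
                  / ((2 * real k + 1) * (2 * real k + 3))))
      / ((2 * real k + 1) ^ 4 * (2 * real k + 3) ^ 4 * (- 16) ^ k))
    sums (1 / 16 * pi ^ 2 * ln 2 - 3 / 4 - 7 * riemann_zeta 3 / 8)"
proof -
  have "telescoper 0 = 3 / 4" by (simp add: telescoper_def wz_kernel_0 harm_expand)
  hence "(\<lambda>k. telescoper (Suc k) - telescoper k) sums (- (3 / 4))"
    using telescope_sums [OF telescoper_tendsto_0] by (metis diff_0)
  from sums_add [OF sums_divide [OF wz_edge_sums [OF wz_F_row_sums], of 16] this]
  have "(\<lambda>k. (wz_F 0 k + wz_G 0 k) / 16 + (telescoper (Suc k) - telescoper k))
      sums ((pi ^ 2 * ln 2 - 14 * riemann_zeta 3) / 16 + - (3 / 4))" .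
  moreover have "(pi ^ 2 * ln 2 - 14 * riemann_zeta 3) / 16 + - (3 / 4)
      = 1 / 16 * pi ^ 2 * ln 2 - 3 / 4 - 7 * riemann_zeta 3 / 8"
    by (simp add: field_simps)
  ultimately show ?thesis unfolding summand_eq by (simp only:)
qed

end
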